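(* Let $d\geq 3$ and $k\geq 3$ be integers, let $G\cong K_{d+1}$, and let $H$ be a graph with $|V(H)|=kd$. Then \[\chi_G(H)+\chi_G(\overline{H})\leq k+2.\] Moreover, if any one of the following holds: (I) $H$ or $\overline{H}$ is $G$-free critical; (II) there is a set $S\subseteq V(H)$ with $|S|=2d$ such that both $H[S]$ and $\overline{H}[S]$ are $G$-free; (III) there is a set $S\subseteq V(H)$ with $|S|=2d$ such that $g(H[S])=2d$ or $g(\overline{H}[S])=2d$; then \[\chi_G(H)+\chi_G(\overline{H})\leq k+1.\]
   Context: All graphs are finite and simple. A copy of $G$ in $H$ is a subgraph of $H$ isomorphic to $G$; $H$ is $G$-free if it contains no copy of $G$. A $G$-free $k$-coloring of $H$ is a map $\pi:V(H)\to\{1,\dots,k\}$ such that each induced subgraph $H[\pi^{-1}(i)]$ is $G$-free; $\chi_G(H)$ is the least $k$ for which such a coloring exists. A graph $H$ with $\chi_G(H)=k$ is $G$-free critical if every proper subgraph $H'$ of $H$ satisfies $\chi_G(H')\leq k-1$. $\overline{H}$ is the complement of $H$, $H[S]$ the induced subgraph on $S$, and $g(\cdot)$ the girth (length of a shortest cycle). *)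

theory Defs
  imports "Graph_Theory.Graph_Theory" "HOL-Library.Extended_Nat" "HOL-Library.FuncSet"
begin

text \<open>
  Finite simple graphs are the symmetric loop-free digraphs without parallel arcs (the locales
  \<open>graph\<close> and \<open>pair_graph\<close>). A subgraph in the sense of \<open>subgraph\<close> need not be symmetric, so
  undirected subgraphs carry the extra condition \<open>graph\<close>.
\<close>

definition is_copy :: "('a,'b) pre_digraph \<Rightarrow> ('c,'d) pre_digraph \<Rightarrow> ('a,'b) pre_digraph \<Rightarrow> bool" where
  "is_copy C G H \<longleftrightarrow> graph C \<and> subgraph C H \<and> digraph_iso C G"

definition graph_free :: "('c,'d) pre_digraph \<Rightarrow> ('a,'b) pre_digraph \<Rightarrow> bool" where
  "graph_free G H \<longleftrightarrow> \<not> (\<exists>C. is_copy C G H)"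

definition free_coloring ::
    "('c,'d) pre_digraph \<Rightarrow> ('a,'b) pre_digraph \<Rightarrow> nat \<Rightarrow> ('a \<Rightarrow> nat) \<Rightarrow> bool" where
  "free_coloring G H k \<pi> \<longleftrightarrow> \<pi> \<in> verts H \<rightarrow> {1..k} \<and>
     (\<forall>i\<in>{1..k}. graph_free G (H \<restriction> {v \<in> verts H. \<pi> v = i}))"

definition free_chromatic_number :: "('c,'d) pre_digraph \<Rightarrow> ('a,'b) pre_digraph \<Rightarrow> nat" where
  "free_chromatic_number G H = (LEAST k. \<exists>\<pi>. free_coloring G H k \<pi>)"

definition free_critical :: "('c,'d) pre_digraph \<Rightarrow> ('a,'b) pre_digraph \<Rightarrow> bool" where
  "free_critical G H \<longleftrightarrow>
     (\<forall>H'. graph H' \<and> subgraph H' H \<and> H' \<noteq> H \<longrightarrow>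
        free_chromatic_number G H' < free_chromatic_number G H)"

definition complement :: "'a pair_pre_digraph \<Rightarrow> 'a pair_pre_digraph" where
  "complement H = \<lparr> pverts = pverts H,
     parcs = {(u, v). u \<in> pverts H \<and> v \<in> pverts H \<and> u \<noteq> v \<and> (u, v) \<notin> parcs H} \<rparr>"

text \<open>
  In a symmetric digraph \<open>cycle\<close> also admits the closed walk along an arc and back; the bound
  \<open>3 \<le> length p\<close> excludes it. The girth of an acyclic graph is \<open>\<infinity>\<close>, the infimum of the empty set.
\<close>

definition girth :: "('a,'b) pre_digraph \<Rightarrow> enat" where
  "girth H = (INF p \<in> {p. pre_digraph.cycle H p \<and> 3 \<le> length p}. enat (length p))"

lemma pair_graph_complement:
  assumes "pair_graph H"
  shows "pair_graph (complement H)"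
proof -
  interpret pair_graph H by fact
  have "sym (parcs H)" using pair_sym_arcs by (simp add: symmetric_def)
  then have "(u, v) \<in> parcs H \<longleftrightarrow> (v, u) \<in> parcs H" for u v by (auto dest: symD)
  moreover have "finite (parcs (complement H))"
    by (rule finite_subset[of _ "pverts H \<times> pverts H"]) (auto simp: complement_def)
  ultimately show ?thesis
    by unfold_locales (auto simp: complement_def symmetric_def intro!: symI)
qed

end

theory Submission
  imports Defs
begin

text \<open>
  The bound \<open>k + 1\<close> holds for every graph on \<open>k d\<close> vertices, by induction on \<open>k\<close>. If some
  \<open>2 d\<close> vertices induce a \<open>K\<^bsub>d+1\<^esub>\<close>-free graph in both \<open>H\<close> and its complement, they can be given one
  new colour on each side, and the rest has \<open>(k - 2) d\<close> vertices. If there is no such set and both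
  \<open>H\<close> and its complement contain a \<open>K\<^bsub>d+1\<^esub>\<close>, then a maximum clique \<open>K\<close> and a maximum independent
  set \<open>J\<close> cover all vertices: a vertex outside, together with \<open>d\<close> vertices of \<open>K\<close> and \<open>d - 1\<close> of
  \<open>J\<close> (or the reverse), would yield such a set. In a split graph of this kind \<open>\<lceil>|K| / d\<rceil>\<close>
  colours suffice for \<open>H\<close> and \<open>\<lceil>|J| / d\<rceil>\<close> for its complement, where \<open>|K| + |J| \<le> k d + 1\<close>.
\<close>

section \<open>Cliques of a binary relation\<close>

text \<open>Adjacency is a bare relation whose diagonal is ignored, so the complement is simply
  \<open>\<lambda>x y. \<not> E x y\<close>. Results for \<open>E\<close> then carry over to the
  complement with cliques and independent sets interchanged.\<close>

definition clique :: "('a \<Rightarrow> 'a \<Rightarrow> bool) \<Rightarrow> 'a set \<Rightarrow> bool" where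
  "clique E C \<longleftrightarrow> (\<forall>x\<in>C. \<forall>y\<in>C. x \<noteq> y \<longrightarrow> E x y)"

text \<open>For finite \<open>S\<close> this is freeness of the induced graph from the complete
  graph on \<open>d + 1\<close> vertices.\<close>

definition clique_bounded :: "('a \<Rightarrow> 'a \<Rightarrow> bool) \<Rightarrow> nat \<Rightarrow> 'a set \<Rightarrow> bool" where
  "clique_bounded E d S \<longleftrightarrow> (\<forall>C\<subseteq>S. clique E C \<longrightarrow> card C \<le> d)"

definition clique_colorable :: "('a \<Rightarrow> 'a \<Rightarrow> bool) \<Rightarrow> nat \<Rightarrow> 'a set \<Rightarrow> nat \<Rightarrow> bool" where
  "clique_colorable E d V p \<longleftrightarrow>
     (\<exists>\<pi>. \<pi> \<in> V \<rightarrow> {1..p} \<and> (\<forall>i\<in>{1..p}. clique_bounded E d {v \<in> V. \<pi> v = i}))"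

text \<open>Maximum in size, not merely under inclusion: one argument below exchanges one vertex of
  \<open>K\<close> for two others.\<close>

definition maximum_clique :: "('a \<Rightarrow> 'a \<Rightarrow> bool) \<Rightarrow> 'a set \<Rightarrow> 'a set \<Rightarrow> bool" where
  "maximum_clique E V K \<longleftrightarrow>
     K \<subseteq> V \<and> clique E K \<and> (\<forall>C\<subseteq>V. clique E C \<longrightarrow> card C \<le> card K)"

lemma clique_subset: "clique E C \<Longrightarrow> D \<subseteq> C \<Longrightarrow> clique E D"
  by (auto simp: clique_def)

lemma not_in_clique: "clique E C \<Longrightarrow> x \<in> C \<Longrightarrow> x \<noteq> y \<Longrightarrow> \<not> E x y \<Longrightarrow> y \<notin> C"
  by (auto simp: clique_def)

lemma clique_inter_co_clique:
  assumes "clique E C" and "clique (\<lambda>x y. \<not> E x y) D" and "x \<in> C \<inter> D" and "y \<in> C \<inter> D"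
  shows "x = y"
  using assms by (auto simp: clique_def)

lemma card_clique_inter_co_clique:
  assumes "clique E C" and "clique (\<lambda>x y. \<not> E x y) D"
  shows "card (C \<inter> D) \<le> 1"
proof -
  have "\<exists>x. C \<inter> D \<subseteq> {x}"
    using clique_inter_co_clique[OF assms] by blast
  then obtain x where "C \<inter> D \<subseteq> {x}" ..
  from card_mono[OF _ this] show ?thesis by simp
qed

lemma ex_maximum_clique:
  assumes "finite V"
  obtains K where "maximum_clique E V K"
proof -
  let ?F = "{C. C \<subseteq> V \<and> clique E C}"
  have "finite ?F" using assms by simp
  moreover have "{} \<in> ?F" by (simp add: clique_def)
  ultimately have "Max (card ` ?F) \<in> card ` ?F" by (intro Max_in) auto
  then obtain K where "K \<in> ?F" "Max (card ` ?F) = card K" by auto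
  moreover have "card C \<le> Max (card ` ?F)" if "C \<in> ?F" for C
    using that \<open>finite ?F\<close> by simp
  ultimately show thesis using that[of K] by (simp add: maximum_clique_def)
qed

text \<open>Otherwise \<open>v\<close> could be added to \<open>K\<close>; symmetry supplies both
  directions of the new adjacencies.\<close>

lemma maximum_clique_nonneighbour:
  assumes "symp E" and "finite V" and "maximum_clique E V K" and "v \<in> V - K"
  obtains x where "x \<in> K" and "\<not> E v x"
proof (rule ccontr)
  assume "\<not> thesis"
  with that have "\<forall>x\<in>K. E v x" by blast
  then have "clique E (insert v K)"
    using assms(1,3) by (auto simp: clique_def maximum_clique_def symp_def)
  moreover have "insert v K \<subseteq> V" using assms(3,4) by (auto simp: maximum_clique_def)
  ultimately have "card (insert v K) \<le> card K" using assms(3) by (simp add: maximum_clique_def)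
  moreover have "finite K"
    using assms(2,3) by (auto simp: maximum_clique_def intro: finite_subset)
  ultimately show False using assms(4) by simp
qed

section \<open>Constructing colourings\<close>

lemma clique_colorable_one: "clique_bounded E d V \<Longrightarrow> clique_colorable E d V 1"
  unfolding clique_colorable_def
  by (rule exI[of _ "\<lambda>_. 1"]) simp

text \<open>Shifting the colours of \<open>V - S\<close> by \<open>p\<close> keeps the two palettes
  disjoint, so each colour class lies in one of the two parts.\<close>

lemma clique_colorable_union:
  assumes "clique_colorable E d S p" and "clique_colorable E d (V - S) q" and "S \<subseteq> V"
  shows "clique_colorable E d V (p + q)"
proof -
  obtain \<rho> where \<rho>: "\<rho> \<in> S \<rightarrow> {1..p}" "\<forall>i\<in>{1..p}. clique_bounded E d {v \<in> S. \<rho> v = i}"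
    using assms(1) by (auto simp: clique_colorable_def)
  obtain \<sigma> where \<sigma>: "\<sigma> \<in> V - S \<rightarrow> {1..q}"
      "\<forall>i\<in>{1..q}. clique_bounded E d {v \<in> V - S. \<sigma> v = i}"
    using assms(2) by (auto simp: clique_colorable_def)
  define \<pi> where "\<pi> v = (if v \<in> S then \<rho> v else p + \<sigma> v)" for v
  have bounds: "1 \<le> \<rho> v \<and> \<rho> v \<le> p" if "v \<in> S" for v using \<rho>(1) that by (auto simp: Pi_iff)
  have bounds': "1 \<le> \<sigma> v \<and> \<sigma> v \<le> q" if "v \<in> V - S" for v using \<sigma>(1) that by (auto simp: Pi_iff)
  have "\<pi> \<in> V \<rightarrow> {1..p+q}"
  proof
    fix v assume "v \<in> V"
    then show "\<pi> v \<in> {1..p+q}"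
      using bounds[of v] bounds'[of v] by (cases "v \<in> S") (auto simp: \<pi>_def)
  qed
  moreover have "clique_bounded E d {v \<in> V. \<pi> v = i}" if "i \<in> {1..p+q}" for i
  proof (cases "i \<le> p")
    case True
    have "{v \<in> V. \<pi> v = i} = {v \<in> S. \<rho> v = i}"
    proof (intro set_eqI)
      fix v
      show "v \<in> {v \<in> V. \<pi> v = i} \<longleftrightarrow> v \<in> {v \<in> S. \<rho> v = i}"
        using bounds'[of v] True assms(3) by (cases "v \<in> S") (auto simp: \<pi>_def)
    qed
    then show ?thesis using \<rho>(2) True that by auto
  next
    case False
    have "{v \<in> V. \<pi> v = i} = {v \<in> V - S. \<sigma> v = i - p}"
    proof (intro set_eqI)
      fix v
      show "v \<in> {v \<in> V. \<pi> v = i} \<longleftrightarrow> v \<in> {v \<in> V - S. \<sigma> v = i - p}"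
        using bounds[of v] bounds'[of v] False assms(3) by (cases "v \<in> S") (auto simp: \<pi>_def)
    qed
    moreover have "i - p \<in> {1..q}" using False that by auto
    ultimately show ?thesis using \<sigma>(2) by simp
  qed
  ultimately show ?thesis unfolding clique_colorable_def by blast
qed

text \<open>
  Cut \<open>K\<close> into pieces of size at most \<open>d\<close> and put each other vertex into the piece of one of its
  non-neighbours.
\<close>

lemma clique_colorable_split:
  assumes "0 < d" and "finite K" and "K \<subseteq> V" and "card K \<le> p * d"
    and indep: "clique (\<lambda>x y. \<not> E x y) (V - K)"
    and nonadj: "\<And>v. v \<in> V - K \<Longrightarrow> \<exists>x\<in>K. \<not> E v x"
  shows "clique_colorable E d V p"
proof -
  obtain h where h: "bij_betw h K {0..<card K}"
    using ex_bij_betw_finite_nat[OF assms(2)] by blast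
  obtain f where f: "\<And>v. v \<in> V - K \<Longrightarrow> f v \<in> K \<and> \<not> E v (f v)"
    using nonadj by metis
  \<comment> \<open>\<open>g v\<close> is the member of \<open>K\<close> whose piece
    \<open>v\<close> joins; the pieces are blocks of \<open>d\<close> consecutive numbers under
    \<open>h\<close>.\<close>
  define g where "g v = (if v \<in> K then v else f v)" for v
  define \<pi> where "\<pi> v = h (g v) div d + 1" for v
  have gK: "g v \<in> K" if "v \<in> V" for v using that f by (auto simp: g_def)
  have "\<pi> \<in> V \<rightarrow> {1..p}"
  proof
    fix v assume "v \<in> V"
    then have "h (g v) < p * d" using gK[of v] h assms(4) by (fastforce dest: bij_betwE)
    then have "h (g v) div d < p" by (rule less_mult_imp_div_less)
    then show "\<pi> v \<in> {1..p}" by (simp add: \<pi>_def)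
  qed
  moreover have "card C \<le> d" if i: "i \<in> {1..p}" and C: "C \<subseteq> {v \<in> V. \<pi> v = i}" "clique E C" for i C
  proof -
    define P where "P = {x \<in> K. h x div d + 1 = i}"
    have "finite P" using assms(2) by (simp add: P_def)
    have "h ` P \<subseteq> {(i-1)*d..<(i-1)*d + d}"
    proof
      fix n assume "n \<in> h ` P"
      then have "n div d = i - 1" by (auto simp: P_def)
      then have "n = (i-1) * d + n mod d" using div_mult_mod_eq[of n d] by simp
      moreover have "n mod d < d" using assms(1) by simp
      ultimately show "n \<in> {(i-1)*d..<(i-1)*d + d}"
        by (metis atLeastLessThan_iff le_add1 nat_add_left_cancel_less)
    qed
    then have "card (h ` P) \<le> d" using card_mono[of "{(i-1)*d..<(i-1)*d + d}" "h ` P"] by simp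
    moreover have "inj_on h P"
      using h by (auto simp: P_def bij_betw_def intro: inj_on_subset)
    ultimately have "card P \<le> d" by (simp add: card_image)
    have CP: "C \<inter> K \<subseteq> P" using C(1) by (auto simp: P_def \<pi>_def g_def)
    show ?thesis
    proof (cases "C \<subseteq> K")
      case True
      with CP have "C \<subseteq> P" by blast
      with \<open>finite P\<close> \<open>card P \<le> d\<close> show ?thesis by (meson card_mono le_trans)
    next
      case False
      then obtain v where v: "v \<in> C" "v \<in> V - K" using C(1) by blast
      \<comment> \<open>The clique has only one vertex \<open>v\<close> in the independent set
        \<open>V - K\<close>, and the non-neighbour \<open>f v\<close> of \<open>v\<close> in
        \<open>P\<close> is missing from it. So \<open>v\<close> at best replaces
        \<open>f v\<close>, and the size stays at most \<open>card P\<close>.\<close>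
      have "C - K \<subseteq> {v}"
        using clique_inter_co_clique[OF C(2) indep] v C(1) by blast
      moreover have "f v \<in> P" using v f[of v] C(1) by (auto simp: P_def \<pi>_def g_def)
      moreover have "f v \<notin> C"
      proof (rule not_in_clique[OF C(2) v(1)])
        show "v \<noteq> f v" "\<not> E v (f v)" using f[OF v(2)] v(2) by auto
      qed
      ultimately have "C \<subseteq> insert v (P - {f v})" using CP by blast
      then have "card C \<le> card (insert v (P - {f v}))"
        using \<open>finite P\<close> by (intro card_mono) auto
      also have "\<dots> \<le> Suc (card (P - {f v}))" by (rule card_insert_le_m1) simp_all
      also have "\<dots> = card P" using \<open>finite P\<close> \<open>f v \<in> P\<close> by (metis card_Suc_Diff1)
      finally show ?thesis using \<open>card P \<le> d\<close> by simp
    qed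
  qed
  ultimately show ?thesis unfolding clique_colorable_def clique_bounded_def by blast
qed

text \<open>With \<open>K = V\<close> the pieces themselves are the colour classes, and there is no
  vertex outside \<open>K\<close> to distribute.\<close>

lemma clique_colorable_card:
  assumes "0 < d" and "finite V" and "card V \<le> p * d"
  shows "clique_colorable E d V p"
  by (rule clique_colorable_split[where K = V]) (use assms in \<open>auto simp: clique_def\<close>)

section \<open>A set of \<open>2 * d\<close> vertices bounded for the relation and its
  complement\<close>

text \<open>
  A clique inside \<open>Z \<union> Y \<union> {m}\<close> has at most one vertex in the independent set \<open>Y\<close>; the set
  \<open>Z\<close> is built so that the vertices taken outside \<open>Z\<close> are always paid for by as many omitted
  vertices of \<open>Z\<close>.
\<close>

lemma ex_blocking_subset:
  assumes "symp E" and "finite V" and K: "maximum_clique E V K" and m: "m \<in> V - K"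
    and Y: "finite Y" "Y \<subseteq> V - K" "m \<notin> Y"
  obtains Z where "Z \<subseteq> K" and "card Z \<le> card Y + 1"
    and "\<And>y. y \<in> Y \<Longrightarrow> \<exists>x\<in>Z. \<not> E y x"
    and "\<exists>x\<in>Z. \<not> E m x"
    and "\<And>y. y \<in> Y \<Longrightarrow> E y m \<Longrightarrow> \<exists>x\<in>Z. \<exists>x'\<in>Z. x \<noteq> x' \<and> \<not> E m x \<and> \<not> E y x'"
proof -
  have sym: "E x y \<longleftrightarrow> E y x" for x y using assms(1) by (auto simp: symp_def)
  have finK: "finite K" using assms(2) K by (auto simp: maximum_clique_def intro: finite_subset)
  have card_Z: "card (insert x (f ` Y)) \<le> card Y + 1" for x and f :: "'a \<Rightarrow> 'a"
  proof -
    have "card (insert x (f ` Y)) \<le> Suc (card (f ` Y))" using Y(1) by (simp add: card_insert_if)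
    also have "\<dots> \<le> card Y + 1" using card_image_le[OF Y(1)] by simp
    finally show ?thesis .
  qed
  obtain x0 where x0: "x0 \<in> K" "\<not> E m x0"
    using maximum_clique_nonneighbour[OF assms(1-4)] by blast
  have "\<exists>x\<in>K. \<not> E y x" if "y \<in> Y" for y
    using maximum_clique_nonneighbour[OF assms(1-3)] that Y(2) by blast
  then obtain f where f: "\<And>y. y \<in> Y \<Longrightarrow> f y \<in> K \<and> \<not> E y (f y)" by metis
  \<comment> \<open>In every case \<open>Z\<close> is a non-neighbour of \<open>m\<close> together
    with one of each \<open>y\<close>. The difficulty is the last property: for \<open>y\<close>
    adjacent to \<open>m\<close> the two omitted vertices must be distinct.\<close>
  show thesis
  proof (cases "\<exists>x1\<in>K. x1 \<noteq> x0 \<and> \<not> E m x1")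
    case True
    then obtain x1 where x1: "x1 \<in> K" "x1 \<noteq> x0" "\<not> E m x1" by blast
    show thesis
    proof (cases "\<exists>y\<in>Y. \<not> E m (f y)")
      case True
      then obtain y0 where y0: "y0 \<in> Y" "\<not> E m (f y0)" by blast
      \<comment> \<open>One of \<open>x0\<close>, \<open>x1\<close> differs from
        \<open>f y0\<close>, so \<open>Z\<close> contains two non-neighbours of \<open>m\<close>;
        where \<open>f y = x\<close>, the vertex \<open>f y0\<close> serves for \<open>m\<close>
        instead.\<close>
      obtain x where x: "x \<in> K" "\<not> E m x" "x \<noteq> f y0" using x0 x1 by metis
      show thesis
      proof (rule that[of "insert x (f ` Y)"])
        fix y assume "y \<in> Y" "E y m"
        define u where "u = (if f y = x then f y0 else x)"
        have "u \<in> insert x (f ` Y)" "f y \<in> insert x (f ` Y)" "u \<noteq> f y \<and> \<not> E m u \<and> \<not> E y (f y)"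
          using x y0 f[OF \<open>y \<in> Y\<close>] \<open>y \<in> Y\<close> by (auto simp: u_def)
        then show "\<exists>u\<in>insert x (f ` Y). \<exists>x'\<in>insert x (f ` Y). u \<noteq> x' \<and> \<not> E m u \<and> \<not> E y x'"
          by blast
      qed (use x f in blast, rule card_Z, (use x f in blast)+)
    next
      case False
      \<comment> \<open>Here every \<open>f y\<close> is adjacent to \<open>m\<close>, so
        \<open>x0\<close> differs from all of them.\<close>
      show thesis
      proof (rule that[of "insert x0 (f ` Y)"])
        fix y assume "y \<in> Y" "E y m"
        then have "f y \<in> insert x0 (f ` Y)" "x0 \<noteq> f y \<and> \<not> E m x0 \<and> \<not> E y (f y)"
          using x0 f[of y] False by auto
        then show "\<exists>u\<in>insert x0 (f ` Y). \<exists>x'\<in>insert x0 (f ` Y). u \<noteq> x' \<and> \<not> E m u \<and> \<not> E y x'"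
          by blast
      qed (use x0 f in blast, rule card_Z, (use x0 f in blast)+)
    qed
  next
    case False
    have "\<exists>x\<in>K. \<not> E y x \<and> (E y m \<longrightarrow> x \<noteq> x0)" if y: "y \<in> Y" for y
    proof (cases "E y m")
      case True
      \<comment> \<open>Now \<open>x0\<close> is the only non-neighbour of \<open>m\<close> in
        \<open>K\<close>. If \<open>y\<close> were adjacent to all of \<open>K - {x0}\<close>,
        exchanging \<open>x0\<close> for \<open>y\<close> and \<open>m\<close> would give a larger
        clique.\<close>
      have "\<exists>x\<in>K - {x0}. \<not> E y x"
      proof (rule ccontr)
        assume "\<not> (\<exists>x\<in>K - {x0}. \<not> E y x)"
        with False have "\<forall>x\<in>K - {x0}. E y x \<and> E x y \<and> E m x \<and> E x m" using sym by blast
        moreover have "E m y" using True sym by blast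
        ultimately have "clique E (insert y (insert m (K - {x0})))"
          using True K unfolding clique_def maximum_clique_def by auto
        moreover have "insert y (insert m (K - {x0})) \<subseteq> V"
          using y Y(2) m K by (auto simp: maximum_clique_def)
        ultimately have "card (insert y (insert m (K - {x0}))) \<le> card K"
          using K by (simp add: maximum_clique_def)
        moreover have "y \<notin> insert m (K - {x0})" "m \<notin> K - {x0}" using y Y m by auto
        ultimately show False using finK card_Suc_Diff1[OF finK x0(1)] by simp
      qed
      then show ?thesis by blast
    qed (use f[OF y] in blast)
    then obtain f' where f': "\<And>y. y \<in> Y \<Longrightarrow> f' y \<in> K \<and> \<not> E y (f' y) \<and> (E y m \<longrightarrow> f' y \<noteq> x0)"
      by metis
    show thesis
    proof (rule that[of "insert x0 (f' ` Y)"])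
      fix y assume "y \<in> Y" "E y m"
      then have "f' y \<in> insert x0 (f' ` Y)" "x0 \<noteq> f' y \<and> \<not> E m x0 \<and> \<not> E y (f' y)"
        using x0 f'[of y] by auto
      then show "\<exists>u\<in>insert x0 (f' ` Y). \<exists>x'\<in>insert x0 (f' ` Y). u \<noteq> x' \<and> \<not> E m u \<and> \<not> E y x'"
        by blast
    qed (use x0 f' in blast, rule card_Z, (use x0 f' in blast)+)
  qed
qed

text \<open>\<open>S\<close> consists of \<open>m\<close>, of \<open>d\<close> vertices
  \<open>X\<close> of \<open>K\<close> containing a blocking set \<open>Z\<close>, and of
  \<open>d - 1\<close> vertices \<open>Y\<close> of \<open>J - K\<close> including \<open>j\<close>.
  The set \<open>Z\<close> limits the cliques of \<open>E\<close>; the adjacency of \<open>m\<close>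
  and \<open>j\<close> limits those of the complement.\<close>

lemma ex_doubly_clique_bounded:
  assumes "symp E" and "finite V" and "2 \<le> d"
    and K: "maximum_clique E V K" "d \<le> card K"
    and J: "J \<subseteq> V" "clique (\<lambda>x y. \<not> E x y) J" "d - 1 \<le> card (J - K)"
    and m: "m \<in> V" "m \<notin> K" "m \<notin> J"
    and j: "j \<in> J - K" "E m j"
  obtains S where "S \<subseteq> V" and "card S = 2 * d"
    and "clique_bounded E d S" and "clique_bounded (\<lambda>x y. \<not> E x y) d S"
proof -
  have finK: "finite K" "K \<subseteq> V" "clique E K"
    using assms(2) K by (auto simp: maximum_clique_def intro: finite_subset)
  have finJ: "finite (J - K)" using J(1) assms(2) by (auto intro: finite_subset)
  obtain Y where Y: "{j} \<subseteq> Y" "Y \<subseteq> J - K" "card Y = d - 1"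
  proof -
    have "card {j} \<le> d - 1" "{j} \<subseteq> J - K" using j(1) assms(3) by auto
    from exists_subset_between[OF this(1) J(3) this(2) finJ] that show thesis by blast
  qed
  have finY: "finite Y" using Y(2) finJ by (rule finite_subset)
  obtain Z where Z: "Z \<subseteq> K" "card Z \<le> card Y + 1" "\<And>y. y \<in> Y \<Longrightarrow> \<exists>x\<in>Z. \<not> E y x" "\<exists>x\<in>Z. \<not> E m x"
     "\<And>y. y \<in> Y \<Longrightarrow> E y m \<Longrightarrow> \<exists>x\<in>Z. \<exists>x'\<in>Z. x \<noteq> x' \<and> \<not> E m x \<and> \<not> E y x'"
  proof -
    have "m \<in> V - K" "Y \<subseteq> V - K" "m \<notin> Y" using m Y(2) J(1) by auto
    from ex_blocking_subset[OF assms(1,2) K(1) this(1) finY this(2,3)] that show thesis .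
  qed
  obtain X where X: "Z \<subseteq> X" "X \<subseteq> K" "card X = d"
  proof -
    have "card Z \<le> d" using Z(2) Y(3) assms(3) by simp
    from exists_subset_between[OF this K(2) Z(1) finK(1)] that show thesis by blast
  qed
  have finX: "finite X" using X(2) finK(1) by (rule finite_subset)
  define S where "S = insert m (X \<union> Y)"
  have "X \<inter> Y = {}" "m \<notin> X \<union> Y" using X(2) Y(2) m by auto
  then have "card S = 2 * d"
    using finX finY X(3) Y(3) assms(3) by (simp add: S_def card_Un_disjoint)
  moreover have "S \<subseteq> V" using X(2) Y(2) finK(2) J(1) m(1) by (auto simp: S_def)
  moreover have "clique_bounded E d S"
    unfolding clique_bounded_def
  proof (intro allI impI)
    fix C assume C: "C \<subseteq> S" "clique E C"
    \<comment> \<open>Exchange count: \<open>A\<close> holds the vertices that \<open>C\<close> may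
      have outside \<open>X\<close>, and \<open>B\<close> holds vertices of \<open>X\<close> that it
      omits.\<close>
    have two: "card C \<le> d"
      if "C \<subseteq> A \<union> (X - B)" "B \<subseteq> X" "card A \<le> card B" "finite A" for A B
    proof -
      have "card C \<le> card (A \<union> (X - B))" using that(1,4) finX by (intro card_mono) auto
      also have "\<dots> \<le> card A + card (X - B)" by (rule card_Un_le)
      also have "\<dots> = card A + (card X - card B)"
        using that(2) finX by (simp add: card_Diff_subset finite_subset)
      also have "\<dots> \<le> d" using that(2,3) X(3) card_mono[OF finX that(2)] by simp
      finally show ?thesis .
    qed
    show "card C \<le> d"
    proof (cases "C \<inter> Y = {}")
      case True
      obtain x where "x \<in> Z" "\<not> E m x" using Z(4) by blast
      show ?thesis
      proof (cases "m \<in> C")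
        case True
        have "m \<noteq> x" using \<open>x \<in> Z\<close> Z(1) m(2) by blast
        with C(2) True have "x \<notin> C" using \<open>\<not> E m x\<close> by (rule not_in_clique)
        with C(1) \<open>C \<inter> Y = {}\<close> have "C \<subseteq> {m} \<union> (X - {x})" by (auto simp: S_def)
        then show ?thesis using \<open>x \<in> Z\<close> X(1) by (intro two[of "{m}" "{x}"]) auto
      next
        case False
        with C(1) \<open>C \<inter> Y = {}\<close> have "C \<subseteq> {} \<union> (X - {})" by (auto simp: S_def)
        then show ?thesis by (rule two) auto
      qed
    next
      case False
      then obtain y where y: "y \<in> C" "y \<in> Y" by blast
      have "C \<inter> Y \<subseteq> {y}" using clique_inter_co_clique[OF C(2) J(2)] y Y(2) by blast
      show ?thesis
      proof (cases "m \<in> C")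
        case True
        have "y \<noteq> m" using y(2) Y(2) m(3) by blast
        then have "E y m" using C(2) y(1) True unfolding clique_def by blast
        \<comment> \<open>Both \<open>m\<close> and \<open>y\<close> lie outside \<open>X\<close>,
          so two distinct omitted vertices of \<open>X\<close> are required.\<close>
        then obtain x x' where x: "x \<in> Z" "x' \<in> Z" "x \<noteq> x'" "\<not> E m x" "\<not> E y x'"
          using Z(5) y(2) by blast
        have "m \<noteq> x" "y \<noteq> x'" using x(1,2) Z(1) m(2) y(2) Y(2) by auto
        then have "x \<notin> C" "x' \<notin> C"
          using not_in_clique[OF C(2) True _ x(4)] not_in_clique[OF C(2) y(1) _ x(5)] by auto
        then have "C \<subseteq> {y, m} \<union> (X - {x, x'})"
          using C(1) \<open>C \<inter> Y \<subseteq> {y}\<close> by (auto simp: S_def)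
        then show ?thesis using x(1-3) X(1)
          by (intro two[of "{y, m}" "{x, x'}"]) (auto simp: card_insert_if)
      next
        case False
        obtain x where x: "x \<in> Z" "\<not> E y x" using Z(3) y(2) by blast
        have "y \<noteq> x" using x(1) Z(1) y(2) Y(2) by blast
        then have "x \<notin> C" using not_in_clique[OF C(2) y(1) _ x(2)] by blast
        then have "C \<subseteq> {y} \<union> (X - {x})"
          using C(1) False \<open>C \<inter> Y \<subseteq> {y}\<close> by (auto simp: S_def)
        then show ?thesis using x(1) X(1) by (intro two[of "{y}" "{x}"]) auto
      qed
    qed
  qed
  moreover have "clique_bounded (\<lambda>x y. \<not> E x y) d S"
    unfolding clique_bounded_def
  proof (intro allI impI)
    fix C assume C: "C \<subseteq> S" "clique (\<lambda>x y. \<not> E x y) C"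
    \<comment> \<open>\<open>X\<close> is a clique of \<open>E\<close>, so \<open>C\<close> takes at
      most one vertex of it; this leaves \<open>d - 1\<close> for \<open>Y\<close> and
      \<open>m\<close>.\<close>
    have "card (C \<inter> X) \<le> 1"
      using card_clique_inter_co_clique[OF clique_subset[OF finK(3) X(2)] C(2)]
      by (simp add: Int_commute)
    moreover have "card (C - X) \<le> d - 1"
    proof (cases "m \<in> C")
      case True
      have "m \<noteq> j" using j(1) m(3) by blast
      \<comment> \<open>The omission of \<open>j\<close> from \<open>Y\<close> pays for
        \<open>m\<close>.\<close>
      then have "j \<notin> C" using not_in_clique[OF C(2) True] j(2) by blast
      then have "C - X \<subseteq> insert m (Y - {j})" using C(1) by (auto simp: S_def)
      then have "card (C - X) \<le> card (insert m (Y - {j}))" using finY by (intro card_mono) auto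
      also have "\<dots> = card Y"
        using card_Suc_Diff1[OF finY, of j] finY Y(1,2) m(3) by (auto simp: card_insert_if)
      finally show ?thesis using Y(3) by simp
    next
      case False
      then have "C - X \<subseteq> Y" using C(1) by (auto simp: S_def)
      then show ?thesis using finY Y(3) card_mono by metis
    qed
    moreover have "card C \<le> card (C \<inter> X) + card (C - X)"
      using card_Un_le[of "C \<inter> X" "C - X"] by (simp add: Int_Diff_Un)
    ultimately show "card C \<le> d" using assms(3) by linarith
  qed
  ultimately show thesis using that by blast
qed

section \<open>Induction on the number of vertices\<close>

lemma clique_colorable_sum:
  assumes "symp E" and "2 \<le> d" and "finite V" and "card V = s * d"
  shows "\<exists>p q. p + q \<le> s + 1 \<and> clique_colorable E d V p \<and> clique_colorable (\<lambda>x y. \<not> E x y) d V q"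
  using assms(3,4)
\<comment> \<open>Removing \<open>S\<close> lowers \<open>s\<close> by two, hence strong induction.
  For \<open>s < 2\<close> no \<open>S\<close> of size \<open>2 * d\<close> fits into
  \<open>V\<close>, so the other case covers the base.\<close>
proof (induction s arbitrary: V rule: less_induct)
  case (less s)
  let ?E' = "\<lambda>x y. \<not> E x y"
  have symE': "symp ?E'" using assms(1) by (auto simp: symp_def)
  have "0 < d" using assms(2) by simp
  show ?case
  proof (cases "\<exists>S\<subseteq>V. card S = 2 * d \<and> clique_bounded E d S \<and> clique_bounded ?E' d S")
    case True
    then obtain S where S: "S \<subseteq> V" "card S = 2 * d" "clique_bounded E d S" "clique_bounded ?E' d S"
      by blast
    have "2 * d \<le> s * d" using card_mono[OF less.prems(1) S(1)] S(2) less.prems(2) by simp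
    then have "2 \<le> s" using \<open>0 < d\<close> by simp
    have "card (V - S) = (s - 2) * d"
      using S(1,2) less.prems by (simp add: card_Diff_subset finite_subset diff_mult_distrib)
    then obtain p q where pq: "p + q \<le> s - 2 + 1" "clique_colorable E d (V - S) p"
        "clique_colorable ?E' d (V - S) q"
      using less.IH[of "s - 2" "V - S"] \<open>2 \<le> s\<close> less.prems(1) by auto
    have "clique_colorable E d V (1 + p)" "clique_colorable ?E' d V (1 + q)"
      by (rule clique_colorable_union[OF clique_colorable_one], fact+)+
    moreover have "(1 + p) + (1 + q) \<le> s + 1" using pq(1) \<open>2 \<le> s\<close> by simp
    ultimately show ?thesis by blast
  next
    case no_S: False
    show ?thesis
    proof (cases "clique_bounded E d V \<or> clique_bounded ?E' d V")
      case True
      \<comment> \<open>One colour suffices on the bounded side, and on the other side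
        \<open>V\<close> is cut into \<open>s\<close> classes of at most \<open>d\<close>
        vertices.\<close>
      have "clique_colorable F d V s" for F
        using clique_colorable_card[OF \<open>0 < d\<close> less.prems(1)] less.prems(2) by simp
      moreover have "1 + s \<le> s + 1" "s + 1 \<le> s + 1" by simp_all
      ultimately show ?thesis using True clique_colorable_one by blast
    next
      case False
      obtain K where K: "maximum_clique E V K" using ex_maximum_clique[OF less.prems(1)] .
      obtain J where J: "maximum_clique ?E' V J" using ex_maximum_clique[OF less.prems(1)] .
      have K': "K \<subseteq> V" "clique E K" and J': "J \<subseteq> V" "clique ?E' J"
        using K J by (auto simp: maximum_clique_def)
      have fin: "finite K" "finite J" using K'(1) J'(1) less.prems(1) by (auto intro: finite_subset)
      have big: "d < card K" "d < card J"
        using False K J unfolding clique_bounded_def maximum_clique_def by (meson le_less_trans not_le)+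
      have KJ: "card (K \<inter> J) \<le> 1" by (rule card_clique_inter_co_clique[OF K'(2) J'(2)])
      have diff: "d \<le> card K" "d - 1 \<le> card (J - K)" "d \<le> card J" "d - 1 \<le> card (K - J)"
        using big KJ fin by (auto simp: card_Diff_subset_Int Int_commute)
      have V: "V = K \<union> J"
      proof (rule ccontr)
        assume "V \<noteq> K \<union> J"
        then obtain m where m: "m \<in> V" "m \<notin> K" "m \<notin> J" using K'(1) J'(1) by blast
        obtain x where x: "x \<in> K" "\<not> E m x"
          using maximum_clique_nonneighbour[OF assms(1) less.prems(1) K] m by blast
        obtain y where y: "y \<in> J" "E m y"
          using maximum_clique_nonneighbour[OF symE' less.prems(1) J] m by blast
        \<comment> \<open>\<open>K\<close> and \<open>J\<close> share at most one vertex, so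
          \<open>x\<close> and \<open>y\<close> cannot both be common. One of them can play
          \<open>j\<close>: \<open>y\<close> for \<open>E\<close>, or \<open>x\<close> for the
          complement with \<open>K\<close> and \<open>J\<close> interchanged.\<close>
        have "x \<noteq> y" using x y by blast
        then have "y \<in> J - K \<or> x \<in> K - J"
          using clique_inter_co_clique[OF K'(2) J'(2)] x(1) y(1) by blast
        then show False
        proof
          assume "y \<in> J - K"
          from ex_doubly_clique_bounded[OF assms(1) less.prems(1) assms(2) K diff(1) J' diff(2) m
              this y(2)]
          obtain S where "S \<subseteq> V" "card S = 2 * d" "clique_bounded E d S" "clique_bounded ?E' d S" .
          then show False using no_S by blast
        next
          assume x': "x \<in> K - J"
          have "clique (\<lambda>x y. \<not> ?E' x y) K" using K'(2) by simp
          from ex_doubly_clique_bounded[OF symE' less.prems(1) assms(2) J diff(3) K'(1) this diff(4)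
              m(1,3,2) x' x(2)]
          obtain S where "S \<subseteq> V" "card S = 2 * d" "clique_bounded ?E' d S"
            "clique_bounded (\<lambda>x y. \<not> ?E' x y) d S" .
          then show False using no_S by auto
        qed
      qed
      \<comment> \<open>Division rounded up, so that \<open>card K \<le> p * d\<close>.\<close>
      define p where "p = (card K + (d - 1)) div d"
      define q where "q = (card J + (d - 1)) div d"
      have up: "a \<le> (a + (d - 1)) div d * d" for a
      proof -
        have "(a + (d - 1)) div d * d + (a + (d - 1)) mod d = a + (d - 1)" by simp
        moreover have "(a + (d - 1)) mod d < d" using \<open>0 < d\<close> by simp
        ultimately show ?thesis by linarith
      qed
      have "clique_colorable E d V p"
      proof (rule clique_colorable_split[where K = K])
        show "clique ?E' (V - K)" using J'(2) V by (auto intro: clique_subset)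
        show "\<exists>x\<in>K. \<not> E v x" if "v \<in> V - K" for v
          using maximum_clique_nonneighbour[OF assms(1) less.prems(1) K that] by blast
      qed (use \<open>0 < d\<close> fin K' up in \<open>auto simp: p_def\<close>)
      moreover have "clique_colorable ?E' d V q"
      proof (rule clique_colorable_split[where K = J])
        show "clique (\<lambda>x y. \<not> ?E' x y) (V - J)" using K'(2) V by (auto intro: clique_subset)
        show "\<exists>x\<in>J. \<not> ?E' v x" if "v \<in> V - J" for v
          using maximum_clique_nonneighbour[OF symE' less.prems(1) J that] by blast
      qed (use \<open>0 < d\<close> fin J' up in \<open>auto simp: q_def\<close>)
      moreover have "p + q \<le> s + 1"
      proof -
        have "card K + card J \<le> s * d + 1"
          using card_Un_Int[OF fin] KJ V less.prems(2) by simp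
        moreover have "p * d \<le> card K + (d - 1)" "q * d \<le> card J + (d - 1)"
          by (simp_all add: p_def q_def)
        \<comment> \<open>The common vertex costs 1 and each rounding at most \<open>d - 1\<close>.
          The total \<open>s * d + 1 + 2 * (d - 1)\<close> is one below \<open>(s + 2) * d\<close>,
          so the inequality is strict.\<close>
        ultimately have "(p + q) * d < (s + 2) * d"
          using \<open>0 < d\<close> by (simp add: algebra_simps)
        then have "p + q < s + 2" by (rule mult_less_cancel2[THEN iffD1, THEN conjunct2])
        then show ?thesis by simp
      qed
      ultimately show ?thesis by blast
    qed
  qed
qed

section \<open>Transfer to graphs and their chromatic numbers\<close>

text \<open>The vertices of a copy of \<open>G\<close> would be a clique of size
  \<open>d + 1\<close> in \<open>S\<close>. \<open>E\<close> only has to contain the arcs: for the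
  complement it will be negated adjacency, which also holds on the diagonal.\<close>

lemma graph_free_complete:
  fixes G :: "('c, 'e) pre_digraph" and H :: "'a pair_pre_digraph"
  assumes "complete_digraph (d + 1) G"
    and "clique_bounded E d S"
    and "\<And>u v. (u, v) \<in> parcs H \<Longrightarrow> E u v"
  shows "graph_free G (with_proj H \<restriction> S)"
  unfolding graph_free_def
proof
  assume "\<exists>C. is_copy C G (with_proj H \<restriction> S)"
  then obtain C where C: "graph C" "subgraph C (with_proj H \<restriction> S)" "digraph_iso C G"
    by (auto simp: is_copy_def)
  then obtain f where f: "pre_digraph.digraph_isomorphism C f" "G = app_iso f C"
    by (auto simp: digraph_iso_def)
  interpret C: graph C by fact
  have inj: "inj_on (iso_verts f) (verts C)" using f(1) by (rule C.digraph_isomorphism_inj_on_verts)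
  then have "card (verts C) = d + 1"
    using assms(1) f(2) by (simp add: complete_digraph_def card_image)
  moreover have "verts C \<subseteq> S" using C(2) by (auto simp: subgraph_def)
  moreover have "clique E (verts C)"
    unfolding clique_def
  proof (intro ballI impI)
    fix u v assume uv: "u \<in> verts C" "v \<in> verts C" "u \<noteq> v"
    then have "(iso_verts f u, iso_verts f v) \<in> arcs_ends G"
      using assms(1) f(2) inj by (auto simp: complete_digraph_def dest: inj_onD)
    \<comment> \<open>An arc of \<open>G\<close> is the image of an arc \<open>a\<close> of
      \<open>C\<close>; injectivity on vertices then identifies the ends of \<open>a\<close> as
      \<open>u\<close> and \<open>v\<close>.\<close>
    then obtain a where a: "a \<in> arcs C" "iso_verts f u = iso_verts f (tail C a)"
        "iso_verts f v = iso_verts f (head C a)"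
      using f C.iso_verts_tail[OF f(1)] C.iso_verts_head[OF f(1)]
      by (auto simp: arcs_ends_def arc_to_ends_def)
    then have "u = tail C a" "v = head C a"
      using uv inj C.tail_in_verts C.head_in_verts by (auto dest: inj_onD)
    moreover have "a \<in> parcs H" "tail C a = fst a" "head C a = snd a"
      using a(1) C(2) by (auto simp: subgraph_def compatible_def)
    ultimately show "E u v" using assms(3) by simp
  qed
  ultimately have "d + 1 \<le> d" using assms(2) unfolding clique_bounded_def by metis
  then show False by simp
qed

lemma free_chromatic_number_le:
  fixes G :: "('c, 'e) pre_digraph" and H :: "'a pair_pre_digraph"
  assumes "complete_digraph (d + 1) G"
    and "clique_colorable E d (pverts H) p"
    and "\<And>u v. (u, v) \<in> parcs H \<Longrightarrow> E u v"
  shows "free_chromatic_number G (with_proj H) \<le> p"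
proof -
  obtain \<pi> where "\<pi> \<in> pverts H \<rightarrow> {1..p}"
    "\<forall>i\<in>{1..p}. clique_bounded E d {v \<in> pverts H. \<pi> v = i}"
    using assms(2) by (auto simp: clique_colorable_def)
  then have "free_coloring G (with_proj H) p \<pi>"
    using graph_free_complete[where E = E, OF assms(1) _ assms(3)] by (simp add: free_coloring_def)
  then show ?thesis unfolding free_chromatic_number_def by (blast intro: Least_le)
qed

theorem theorem6:
  fixes d k :: nat
    and G :: "('c, 'e) pre_digraph"
    and H :: "'a pair_pre_digraph"
  assumes "d \<ge> 3" and "k \<ge> 3"
    and "complete_digraph (d + 1) G"
    and "pair_graph H"
    and "card (pverts H) = k * d"
  shows "free_chromatic_number G (with_proj H)
           + free_chromatic_number G (with_proj (complement H)) \<le> k + 2 \<and>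
         ((free_critical G (with_proj H) \<or> free_critical G (with_proj (complement H))) \<or>
          (\<exists>S \<subseteq> pverts H. card S = 2 * d \<and>
             graph_free G (with_proj H \<restriction> S) \<and> graph_free G (with_proj (complement H) \<restriction> S)) \<or>
          (\<exists>S \<subseteq> pverts H. card S = 2 * d \<and>
             (girth (with_proj H \<restriction> S) = enat (2 * d) \<or>
              girth (with_proj (complement H) \<restriction> S) = enat (2 * d)))
          \<longrightarrow> free_chromatic_number G (with_proj H)
                + free_chromatic_number G (with_proj (complement H)) \<le> k + 1)"
proof -
  interpret pair_graph H by fact
  let ?E = "\<lambda>u v. (u, v) \<in> parcs H"
  have "symp ?E" using pair_sym_arcs by (auto simp: symmetric_def symp_def dest: symD)
  then obtain p q where pq: "p + q \<le> k + 1" "clique_colorable ?E d (pverts H) p"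
      "clique_colorable (\<lambda>u v. \<not> ?E u v) d (pverts H) q"
    using clique_colorable_sum[of ?E d "pverts H" k] assms(1,5) pair_finite_verts by auto
  have "free_chromatic_number G (with_proj H) \<le> p"
    using free_chromatic_number_le[OF assms(3) pq(2)] by simp
  moreover have "free_chromatic_number G (with_proj (complement H)) \<le> q"
    by (rule free_chromatic_number_le[OF assms(3), where E = "\<lambda>u v. \<not> ?E u v"])
      (use pq(3) in \<open>auto simp: complement_def\<close>)
  ultimately show ?thesis using pq(1) by linarith
qed

end
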